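(* Let $d,M\ge 1$ be integers and $p\in[0,1]$. Under the (uncorrected) probabilistic-sparsity scheme with per-coordinate non-zero probability $p$ and dimension $d$, a random index vector $r\in\mathbb{R}^d$ is entirely zero with probability $$\Pr(r=0)=(1-p)^d.$$ Moreover, for a vocabulary of $M$ independent prototype vectors $r_1,\dots,r_M$ generated by this scheme, the probability that at least one of them is degenerate (i.e. equal to the zero vector) is $$1-\bigl(1-(1-p)^d\bigr)^M.$$
   Context: (Uncorrected) probabilistic-sparsity scheme with parameters $p$ and $d$: a random index vector $r=(r_1,\dots,r_d)\in\mathbb{R}^d$ has independent coordinates, where each coordinate is non-zero with probability $p$, taking value $+1$ or $-1$ with equal probability when non-zero (so it equals $+1$ with probability $p/2$, $-1$ with probability $p/2$, and $0$ with probability $1-p$). "Uncorrected" means that all-zero draws are not rejected or resampled. *)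

theory Defs
  imports "HOL-Probability.Probability"
begin

context prob_space
begin

text \<open>
  The index vector is a random variable on an arbitrary probability space; \<^term>\<open>r \<omega> $ i\<close> is
  its \<open>i\<close>-th coordinate. Measurability is part of \<^const>\<open>indep_vars\<close>. The coordinate laws apply
  to every draw without conditioning, so all-zero draws are not rejected.
\<close>

definition prob_sparse_vector :: "real \<Rightarrow> ('a \<Rightarrow> real ^ 'd) \<Rightarrow> bool" where
  "prob_sparse_vector p r \<longleftrightarrow>
     indep_vars (\<lambda>_. borel) (\<lambda>i \<omega>. r \<omega> $ i) UNIV \<and>
     (\<forall>i. \<P>(\<omega> in M. r \<omega> $ i = 1) = p / 2 \<and>
          \<P>(\<omega> in M. r \<omega> $ i = - 1) = p / 2 \<and>
          \<P>(\<omega> in M. r \<omega> $ i = 0) = 1 - p)"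

definition prob_sparse_vocabulary :: "real \<Rightarrow> nat \<Rightarrow> (nat \<Rightarrow> 'a \<Rightarrow> real ^ 'd) \<Rightarrow> bool" where
  "prob_sparse_vocabulary p m R \<longleftrightarrow>
     indep_vars (\<lambda>_. borel) R {1..m} \<and> (\<forall>j\<in>{1..m}. prob_sparse_vector p (R j))"

end

end

theory Submission
  imports Defs
begin

text \<open>
  Both formulas compute the probability of an intersection of independent events by the product
  rule \<open>prob_all_in\<close>. A vector vanishes iff each of its coordinates does, and the \<open>d\<close> coordinates
  vanish independently, each with probability \<open>1 - p\<close>; hence a draw is zero with probability
  \<open>(1 - p) ^ d\<close>. For the vocabulary, pass to the complement: no prototype is degenerate iff
  each of the \<open>M\<close> independent prototypes avoids the zero vector, and each of them does so with
  probability \<open>1 - (1 - p) ^ d\<close>.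
\<close>

context prob_space
begin

lemma prob_all_in:
  assumes "indep_vars (\<lambda>_. N) X I" and "finite I" and "I \<noteq> {}" and "A \<in> sets N"
  shows "\<P>(\<omega> in M. \<forall>i\<in>I. X i \<omega> \<in> A) = (\<Prod>i\<in>I. \<P>(\<omega> in M. X i \<omega> \<in> A))"
proof -
  have "prob (\<Inter>i\<in>I. X i -` A \<inter> space M) = (\<Prod>i\<in>I. prob (X i -` A \<inter> space M))"
    using assms by (intro indep_varsD) auto
  moreover have "(\<Inter>i\<in>I. X i -` A \<inter> space M) = {\<omega> \<in> space M. \<forall>i\<in>I. X i \<omega> \<in> A}"
    using \<open>I \<noteq> {}\<close> by auto
  moreover have "X i -` A \<inter> space M = {\<omega> \<in> space M. X i \<omega> \<in> A}" for i
    by auto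
  ultimately show ?thesis
    by simp
qed

lemma prob_sparse_vector_eq_0:
  fixes r :: "'a \<Rightarrow> real ^ 'd"
  assumes "prob_sparse_vector p r"
  shows "\<P>(\<omega> in M. r \<omega> = 0) = (1 - p) ^ CARD('d)"
proof -
  have "\<P>(\<omega> in M. r \<omega> = 0) = \<P>(\<omega> in M. \<forall>i\<in>UNIV. r \<omega> $ i \<in> {0})"
    by (simp add: vec_eq_iff)
  also have "\<dots> = (\<Prod>i\<in>UNIV. \<P>(\<omega> in M. r \<omega> $ i \<in> {0}))"
    using assms by (intro prob_all_in) (auto simp: prob_sparse_vector_def)
  also have "\<dots> = (1 - p) ^ CARD('d)"
    using assms by (simp add: prob_sparse_vector_def)
  finally show ?thesis .
qed

lemma prob_sparse_vocabulary_ex_eq_0: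
  fixes R :: "nat \<Rightarrow> 'a \<Rightarrow> real ^ 'd"
  assumes R: "prob_sparse_vocabulary p m R" and "1 \<le> m"
  shows "\<P>(\<omega> in M. \<exists>j\<in>{1..m}. R j \<omega> = 0) = 1 - (1 - (1 - p) ^ CARD('d)) ^ m"
proof -
  have indep: "indep_vars (\<lambda>_. borel) R {1..m}"
    using R by (simp add: prob_sparse_vocabulary_def)
  have meas: "R j \<in> borel_measurable M" if "j \<in> {1..m}" for j
    using indep that by (auto simp: indep_vars_def)
  have zero: "{\<omega> \<in> space M. R j \<omega> = 0} \<in> events" if "j \<in> {1..m}" for j
    using meas[OF that] by measurable
  have nonzero: "\<P>(\<omega> in M. R j \<omega> \<in> - {0}) = 1 - (1 - p) ^ CARD('d)" if "j \<in> {1..m}" for j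
    using prob_neg[OF zero[OF that]] prob_sparse_vector_eq_0[of p "R j"] R that
    by (simp add: prob_sparse_vocabulary_def)
  have "{\<omega> \<in> space M. \<exists>j\<in>{1..m}. R j \<omega> = 0} = (\<Union>j\<in>{1..m}. {\<omega> \<in> space M. R j \<omega> = 0})"
    by auto
  then have ev: "{\<omega> \<in> space M. \<exists>j\<in>{1..m}. R j \<omega> = 0} \<in> events"
    using zero by (simp add: sets.finite_UN)
  have "\<P>(\<omega> in M. \<forall>j\<in>{1..m}. R j \<omega> \<in> - {0}) = (\<Prod>j\<in>{1..m}. \<P>(\<omega> in M. R j \<omega> \<in> - {0}))"
    using indep \<open>1 \<le> m\<close> by (intro prob_all_in) auto
  also have "\<dots> = (1 - (1 - p) ^ CARD('d)) ^ m"
    using prod.cong[OF refl nonzero, of "{1..m}"] by simp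
  finally show ?thesis
    using prob_neg[OF ev] by simp
qed

end

theorem proposition2:
  fixes \<Omega> :: "'a measure" and p :: real and M :: nat
  assumes "prob_space \<Omega>" and "0 \<le> p" and "p \<le> 1" and "1 \<le> M"
  shows "(\<forall>r :: 'a \<Rightarrow> real ^ 'd.
            prob_space.prob_sparse_vector \<Omega> p r \<longrightarrow>
            \<P>(\<omega> in \<Omega>. r \<omega> = 0) = (1 - p) ^ CARD('d)) \<and>
         (\<forall>R :: nat \<Rightarrow> 'a \<Rightarrow> real ^ 'd.
            prob_space.prob_sparse_vocabulary \<Omega> p M R \<longrightarrow>
            \<P>(\<omega> in \<Omega>. \<exists>j\<in>{1..M}. R j \<omega> = 0) = 1 - (1 - (1 - p) ^ CARD('d)) ^ M)"
  using prob_space.prob_sparse_vector_eq_0[OF assms(1)]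
    prob_space.prob_sparse_vocabulary_ex_eq_0[OF assms(1) _ assms(4)]
  by blast

end
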